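(* Let $\mu=\max_{0\le\theta\le\pi/4}\dfrac{(\pi/2)-2\theta+\sin 2\theta}{\cos\theta}\approx1.61589$. There exists a function $g$ with $g(r)/r\to0$ as $r\to\infty$ such that for every positive integer $r$ there exists a $\mathrm{DD}^*(m,r)$ with $m\ge\sqrt{\tfrac{2}{\sqrt3}}\,\mu\,\lfloor r/2\rfloor-g(r)$ (approximately $0.86819\,r$).
   Context: The hexagonal grid is the lattice $\{i(1,0)+j(-\tfrac12,\tfrac{\sqrt3}{2}): i,j\in\mathbb{Z}\}\subset\mathbb{R}^2$, the centres of a regular hexagonal tiling with adjacent centres at distance $1$. A $\mathrm{DD}^*(m,r)$ is a set of $m$ points ("dots") of the hexagonal grid such that any two dots are at Euclidean distance at most $r$, and the vectors $a-b$, over ordered pairs $(a,b)$ of distinct dots, are pairwise distinct (i.e. the lines joining pairs of dots differ in length or slope). *)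

theory Defs
  imports "HOL-Analysis.Analysis"
begin

definition hex_grid :: "(real ^ 2) set" where
  "hex_grid =
     {of_int i *\<^sub>R vector [1, 0] + of_int j *\<^sub>R vector [- 1 / 2, sqrt 3 / 2] | i j :: int. True}"

definition DD_star :: "nat \<Rightarrow> real \<Rightarrow> (real ^ 2) set \<Rightarrow> bool" where
  "DD_star m r D \<longleftrightarrow>
     D \<subseteq> hex_grid \<and> finite D \<and> card D = m \<and>
     (\<forall>a\<in>D. \<forall>b\<in>D. dist a b \<le> r) \<and>
     inj_on (\<lambda>(a, b). a - b) {(a, b). a \<in> D \<and> b \<in> D \<and> a \<noteq> b}"

definition mu_fun :: "real \<Rightarrow> real" where
  "mu_fun \<theta> = (pi / 2 - 2 * \<theta> + sin (2 * \<theta>)) / cos \<theta>"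

definition mu :: real where
  "mu = (SUP \<theta>\<in>{0..pi/4}. mu_fun \<theta>)"

text \<open>The supremum defining \<^const>\<open>mu\<close> is a maximum.\<close>

lemma mu_attained: "\<exists>\<theta>\<in>{0..pi/4}. mu_fun \<theta> = mu \<and> (\<forall>\<phi>\<in>{0..pi/4}. mu_fun \<phi> \<le> mu_fun \<theta>)"
proof -
  have "cos \<theta> \<noteq> 0" if "\<theta> \<in> {0..pi/4}" for \<theta>
  proof -
    have "- (pi / 2) < \<theta>" "\<theta> < pi / 2"
      using that pi_gt_zero unfolding atLeastAtMost_iff by linarith+
    then show ?thesis
      using cos_gt_zero_pi[of \<theta>] by simp
  qed
  then have "continuous_on {0..pi/4} mu_fun"
    unfolding mu_fun_def by (intro continuous_intros) auto
  moreover have "{0..pi/4} \<noteq> {}"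
    by simp
  ultimately obtain \<theta> where \<theta>: "\<theta> \<in> {0..pi/4}" "\<forall>\<phi>\<in>{0..pi/4}. mu_fun \<phi> \<le> mu_fun \<theta>"
    using continuous_attains_sup[of "{0..pi/4}" mu_fun] by auto
  then have "mu = mu_fun \<theta>"
    unfolding mu_def by (intro cSup_eq_maximum) auto
  with \<theta> show ?thesis
    by metis
qed

end

theory Submission
  imports Defs "HOL-Number_Theory.Cong" "HOL-Number_Theory.Prime_Powers" "HOL-Real_Asymp.Real_Asymp"
begin

text \<open>
  For a prime \<open>p > 2\<close> the points of the hexagonal grid with coordinates \<open>(i, j)\<close> satisfying
  \<open>j + c = i\<^sup>2\<close> modulo \<open>p\<close> form, modulo \<open>p\<close>, a Sidon set of \<open>p\<close> elements in a group of order
  \<open>p\<^sup>2\<close>. Their restriction to any set \<open>S\<close> of grid points that are pairwise incongruent modulo \<open>p\<close>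
  therefore has distinct differences, and for a suitable \<open>c\<close> it has at least \<open>card S / p\<close> elements.
  Take for \<open>S\<close> the disc of diameter \<open>r\<close> truncated by the regular hexagon of inradius \<open>p / 2\<close>, which is
  the Voronoi cell of \<open>p\<close> times the grid.

  The constant \<open>mu\<close> is what one gets from truncating the disc by an optimally chosen square. The
  hexagon does strictly better, and it still does at least as well as \<open>mu\<close> for every \<open>p\<close> between
  \<open>0.869 r\<close> and \<open>1.044 r\<close>. The ratio of these bounds exceeds \<open>6/5\<close>, so that Chebyshev's
  elementary estimates \<open>A x \<le> \<psi>(x) \<le> 6/5 A x\<close>, up to lower order terms, already provide such a
  prime and the prime number theorem is not needed.
\<close>

section \<open>Primes in short intervals\<close>

definition chebyshev_psi :: "nat \<Rightarrow> real" where
  "chebyshev_psi n = (\<Sum>d=1..n. mangoldt d)"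

text \<open>Write \<open>ln m\<close> as the sum of \<open>mangoldt\<close> over the divisors of
  \<open>m\<close> and exchange the sums. Since \<open>n div d = 0\<close> beyond \<open>n\<close>,
  any \<open>N \<ge> n\<close> may bound the range, which puts several factorials over a common
  range.\<close>

lemma ln_fact_eq_sum_mangoldt:
  assumes "n \<le> N"
  shows "ln (fact n) = (\<Sum>d=1..N. mangoldt d * real (n div d))"
proof -
  have "ln (fact n :: real) = (\<Sum>m=1..n. ln (real m))"
    unfolding fact_prod of_nat_prod by (rule ln_prod) auto
  also have "\<dots> = (\<Sum>m=1..n. \<Sum>d | d dvd m. mangoldt d)"
    by (intro sum.cong refl) (simp add: mangoldt_sum)
  also have "\<dots> = (\<Sum>m=1..n. \<Sum>d=1..N. if d dvd m then mangoldt d else 0)"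
  proof (rule sum.cong[OF refl])
    fix m assume m: "m \<in> {1..n}"
    have "1 \<le> d \<and> d \<le> N" if "d dvd m" for d
      using dvd_pos_nat[of m d] dvd_imp_le[OF that] that m assms by auto
    then have "{d. d dvd m} = {1..N} \<inter> {d. d dvd m}"
      by auto
    then show "(\<Sum>d | d dvd m. mangoldt d) = (\<Sum>d=1..N. if d dvd m then mangoldt d else (0::real))"
      by (simp add: sum.If_cases)
  qed
  also have "\<dots> = (\<Sum>d=1..N. \<Sum>m=1..n. if d dvd m then mangoldt d else 0)"
    by (rule sum.swap)
  also have "\<dots> = (\<Sum>d=1..N. mangoldt d * real (n div d))"
  proof (intro sum.cong refl)
    fix d assume d: "d \<in> {1..N}"
    have "{m\<in>{1..n}. d dvd m} = (\<lambda>k. d * k) ` {1..n div d}"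
      using d by (auto simp: less_eq_div_iff_mult_less_eq mult.commute elim!: dvdE)
    moreover have "inj_on (\<lambda>k. d * k) {1..n div d}"
      using d by (auto simp: inj_on_def)
    ultimately have "card {m\<in>{1..n}. d dvd m} = n div d"
      by (simp add: card_image)
    then show "(\<Sum>m=1..n. if d dvd m then mangoldt d else (0::real)) = mangoldt d * real (n div d)"
      by (simp add: sum.If_cases Int_def mult.commute)
  qed
  finally show ?thesis .
qed

text \<open>Chebyshev's factorial quotient. Since 1 + 1/30 = 1/2 + 1/3 + 1/5, the terms of order
  \<open>n * ln n\<close> cancel.\<close>

definition chebyshev_D :: "nat \<Rightarrow> real" where
  "chebyshev_D n = ln (fact n) + ln (fact (n div 30))
     - ln (fact (n div 2)) - ln (fact (n div 3)) - ln (fact (n div 5))"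

text \<open>\<open>c\<close> is the coefficient of \<open>mangoldt d\<close> in
  \<open>chebyshev_D n\<close> when \<open>y = n div d\<close>. By the same identity it depends only
  on \<open>y\<close> modulo 30, so thirty residues are checked.\<close>

lemma chebyshev_coeff:
  fixes y :: nat
  defines "c \<equiv> int y + int (y div 30) - int (y div 2) - int (y div 3) - int (y div 5)"
  shows "0 \<le> c" "c \<le> 1" "0 < y \<Longrightarrow> y < 6 \<Longrightarrow> c = 1"
proof -
  define q t where "q = y div 30" and "t = y mod 30"
  have t: "t < 30" and y: "y = 30 * q + t"
    by (auto simp: q_def t_def)
  have "y div 2 = 15 * q + t div 2" "y div 3 = 10 * q + t div 3" "y div 5 = 6 * q + t div 5"
       "y div 30 = q + t div 30"
    unfolding y by presburger+
  then have c: "c = int t + int (t div 30) - int (t div 2) - int (t div 3) - int (t div 5)"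
    unfolding c_def y by simp
  have "t \<in> {..<30}"
    using t by simp
  then have "0 \<le> c \<and> c \<le> 1"
    unfolding c by (auto simp: lessThan_nat_numeral lessThan_Suc)
  then show "0 \<le> c" "c \<le> 1"
    by auto
  assume "0 < y" "y < 6"
  then have "y \<in> {1,2,3,4,5}"
    by auto
  then show "c = 1"
    unfolding c_def by auto
qed

lemma chebyshev_D_eq_sum:
  "chebyshev_D n = (\<Sum>d=1..n. mangoldt d * of_int (int (n div d) + int (n div d div 30)
     - int (n div d div 2) - int (n div d div 3) - int (n div d div 5)))"
proof -
  have "ln (fact (n div k)) = (\<Sum>d=1..n. mangoldt d * real (n div d div k))" for k
    using ln_fact_eq_sum_mangoldt[of "n div k" n] by (simp add: div_mult2_eq[symmetric] mult.commute)
  from this[of 1] this[of 2] this[of 3] this[of 5] this[of 30] show ?thesis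
    unfolding chebyshev_D_def
    by (simp add: sum.distrib sum_subtractf algebra_simps)
qed

lemma chebyshev_D_le_psi: "chebyshev_D n \<le> chebyshev_psi n"
  unfolding chebyshev_D_eq_sum chebyshev_psi_def
proof (intro sum_mono mult_left_le mangoldt_nonneg)
  fix d
  show "of_int (int (n div d) + int (n div d div 30) - int (n div d div 2)
      - int (n div d div 3) - int (n div d div 5)) \<le> (1::real)"
    using chebyshev_coeff(2)[of "n div d"] by linarith
qed

text \<open>For \<open>n div 6 < d \<le> n\<close> the quotient \<open>n div d\<close> lies between
  1 and 5, where the coefficient is exactly 1; the other coefficients are nonnegative.\<close>

lemma psi_diff_le_chebyshev_D: "chebyshev_psi n - chebyshev_psi (n div 6) \<le> chebyshev_D n"
proof -
  let ?c = "\<lambda>y::nat. int y + int (y div 30) - int (y div 2) - int (y div 3) - int (y div 5)"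
  have "chebyshev_psi n = chebyshev_psi (n div 6) + (\<Sum>d\<in>{n div 6<..n}. mangoldt d)"
    unfolding chebyshev_psi_def
    by (subst sum.union_disjoint[symmetric]) (auto intro!: sum.cong)
  moreover have "(\<Sum>d\<in>{n div 6<..n}. mangoldt d) = (\<Sum>d\<in>{n div 6<..n}. mangoldt d * of_int (?c (n div d)) :: real)"
  proof (intro sum.cong refl)
    fix d assume d: "d \<in> {n div 6<..n}"
    then have "0 < n div d" "n div d < 6"
      by (auto simp: div_greater_zero_iff div_less_iff_less_mult mult.commute)
    then have "?c (n div d) = 1"
      by (rule chebyshev_coeff(3))
    then show "mangoldt d = (mangoldt d * of_int (?c (n div d)) :: real)"
      by (simp del: of_int_add of_int_diff)
  qed
  moreover have "\<dots> \<le> (\<Sum>d=1..n. mangoldt d * of_int (?c (n div d)))"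
    using chebyshev_coeff(1)
    by (intro sum_mono2) (auto intro!: mult_nonneg_nonneg simp: mangoldt_nonneg simp del: of_int_add of_int_diff)
  ultimately show ?thesis
    unfolding chebyshev_D_eq_sum by linarith
qed

section \<open>Stirling-type bounds and the size of \<open>chebyshev_D\<close>\<close>

lemma ln_fact_lower: "n > 0 \<Longrightarrow> real n * ln (real n) - real n \<le> ln (fact n)"
proof (induction n rule: nat_induct_non_zero)
  case (Suc n)
  have "ln (1 + 1 / real n) \<le> 1 / real n"
    by (rule ln_add_one_self_le_self) simp
  moreover have "1 + 1 / real n = real (Suc n) / real n"
    using Suc by (simp add: field_simps)
  ultimately have "ln (real (Suc n)) - ln (real n) \<le> 1 / real n"
    using Suc by (simp add: ln_div del: of_nat_Suc)
  then have "real n * (ln (real (Suc n)) - ln (real n)) \<le> 1"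
    using Suc by (simp add: field_simps del: of_nat_Suc)
  moreover have "ln (fact (Suc n) :: real) = ln (real (Suc n)) + ln (fact n)"
    by (simp add: ln_mult del: of_nat_Suc)
  ultimately show ?case
    using Suc by (simp add: algebra_simps)
qed simp

lemma ln_fact_upper: "n > 0 \<Longrightarrow> ln (fact n) \<le> real n * ln (real n) - real n + ln (real n) + 1"
proof (induction n rule: nat_induct_non_zero)
  case (Suc n)
  have "ln (real n / real (Suc n)) \<le> real n / real (Suc n) - 1"
    using Suc by (intro ln_le_minus_one) simp
  then have "ln (real n) - ln (real (Suc n)) \<le> - 1 / real (Suc n)"
    using Suc by (simp add: ln_div field_simps)
  then have "real (Suc n) * (ln (real n) - ln (real (Suc n))) \<le> - 1"
    by (simp add: field_simps)
  moreover have "ln (fact (Suc n) :: real) = ln (real (Suc n)) + ln (fact n)"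
    by (simp add: ln_mult del: of_nat_Suc)
  ultimately show ?case
    using Suc by (simp add: algebra_simps)
qed simp

lemma x_ln_x_minus_x_mono:
  fixes x y :: real
  assumes "1 \<le> x" "x \<le> y"
  shows "x * ln x - x \<le> y * ln y - y"
proof (rule DERIV_nonneg_imp_nondecreasing[OF assms(2)])
  fix t assume "x \<le> t" "t \<le> y"
  then show "\<exists>D. ((\<lambda>x. x * ln x - x) has_real_derivative D) (at t) \<and> 0 \<le> D"
    using assms by (intro exI[of _ "ln t"]) (auto intro!: derivative_eq_intros)
qed

lemma ln_fact_div_approx:
  assumes "k > 0" "n \<ge> k"
  defines "x \<equiv> real n / real k"
  shows "\<bar>ln (fact (n div k)) - (x * ln x - x)\<bar> \<le> ln (real n) + 2"
proof -
  define m where "m = n div k"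
  have m: "m > 0"
    using assms by (simp add: m_def div_greater_zero_iff)
  have mx: "real m \<le> x" "x \<le> real (Suc m)" "x \<le> real n"
  proof -
    show "real m \<le> x"
      unfolding m_def x_def by (rule of_nat_div_le_of_nat)
    have "n < k * Suc m"
      using assms by (simp add: m_def dividend_less_times_div)
    then have "real n \<le> real k * real (Suc m)"
      by (metis less_imp_le of_nat_le_iff of_nat_mult)
    then show "x \<le> real (Suc m)"
      using assms by (simp add: x_def field_simps)
    show "x \<le> real n"
      using assms by (simp add: x_def field_simps)
  qed
  have x1: "1 \<le> x"
    using m mx by linarith
  have "ln (fact m) \<le> x * ln x - x + ln x + 1"
  proof -
    have "ln (real m) \<le> ln x"
      using m mx by simp
    then show ?thesis
      using ln_fact_upper[OF m] x_ln_x_minus_x_mono[of "real m" x] m mx by linarith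
  qed
  moreover have "ln x \<le> ln (real n)"
    using mx x1 by simp
  \<comment> \<open>The lower bound is applied at \<open>Suc m\<close>, the integer above
    \<open>x\<close>; returning to \<open>fact m\<close> costs one logarithm.\<close>
  moreover have "x * ln x - x \<le> ln (fact m) + ln (real (Suc m))"
    using ln_fact_lower[of "Suc m"] x_ln_x_minus_x_mono[OF x1 mx(2)] by (simp add: ln_mult)
  moreover have "ln (real (Suc m)) \<le> ln (real n) + 1"
  proof -
    have "ln (real (Suc m)) \<le> ln (2 * real n)"
      using m mx by simp
    also have "\<dots> = ln 2 + ln (real n)"
      using m mx by (simp add: ln_mult)
    finally show ?thesis
      using ln_2_less_1 by simp
  qed
  ultimately show ?thesis
    unfolding m_def[symmetric] by linarith
qed

text \<open>The linear coefficient of \<open>chebyshev_D\<close>, about 0.9213: only the terms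
  \<open>ln k / k\<close> survive the cancellation.\<close>

definition chebyshev_const :: real where
  "chebyshev_const = ln 2 / 2 + ln 3 / 3 + ln 5 / 5 - ln 30 / 30"

lemma chebyshev_const_pos: "chebyshev_const > 0"
proof -
  have "ln (30::real) = ln 2 + ln 3 + ln 5"
    using ln_mult[of 6 "5::real"] ln_mult[of 2 "3::real"] by simp
  then show ?thesis
    by (simp add: chebyshev_const_def field_simps add_pos_pos)
qed

lemma chebyshev_D_approx:
  assumes "n \<ge> 30"
  shows "\<bar>chebyshev_D n - chebyshev_const * real n\<bar> \<le> 5 * (ln (real n) + 2)"
proof -
  define N E L where "N = real n" and "E = (\<lambda>x::real. x * ln x - x)"
    and "L = (\<lambda>k. ln (fact (n div k)) :: real)"
  have "N > 0"
    using assms by (simp add: N_def)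
  then have "E N + E (N/30) - E (N/2) - E (N/3) - E (N/5) = chebyshev_const * N"
    by (simp add: E_def ln_div chebyshev_const_def algebra_simps)
  moreover have "\<bar>L k - E (N / real k)\<bar> \<le> ln N + 2" if "0 < k" "k \<le> 30" for k
    using ln_fact_div_approx[of k n] assms that by (simp add: N_def E_def L_def)
  from this[of 1] this[of 2] this[of 3] this[of 5] this[of 30]
  have "\<bar>L 1 - E N\<bar> \<le> ln N + 2" "\<bar>L 2 - E (N/2)\<bar> \<le> ln N + 2" "\<bar>L 3 - E (N/3)\<bar> \<le> ln N + 2"
    "\<bar>L 5 - E (N/5)\<bar> \<le> ln N + 2" "\<bar>L 30 - E (N/30)\<bar> \<le> ln N + 2"
    by simp_all
  ultimately have "\<bar>L 1 + L 30 - L 2 - L 3 - L 5 - chebyshev_const * N\<bar> \<le> 5 * (ln N + 2)"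
    by (auto simp: abs_le_iff)
  then show ?thesis
    by (simp add: chebyshev_D_def N_def L_def)
qed

lemma chebyshev_D_eventually:
  assumes "e > 0"
  shows "\<forall>\<^sub>F n in sequentially. \<bar>chebyshev_D n - chebyshev_const * real n\<bar> \<le> e * real n"
proof -
  have "\<forall>\<^sub>F n::nat in sequentially. 5 * (ln (real n) + 2) \<le> e * real n"
    using assms by real_asymp
  then show ?thesis
    using eventually_ge_at_top[of 30]
    by eventually_elim (use chebyshev_D_approx in force)
qed

section \<open>Bounds for \<open>chebyshev_psi\<close> and existence of primes\<close>

text \<open>Iterating the bound on \<open>chebyshev_psi n - chebyshev_psi (n div 6)\<close> gives a
  geometric series of ratio 1/6, whence the factor 6/5. The induction carries this out, with
  \<open>C\<close> absorbing the small \<open>n\<close>.\<close>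

lemma psi_upper:
  assumes "e > 0"
  obtains C where "\<And>n. chebyshev_psi n \<le> 6/5 * (chebyshev_const + e) * real n + C"
proof -
  let ?b = "chebyshev_const + e"
  obtain n0 where n0: "\<And>n. n \<ge> n0 \<Longrightarrow> chebyshev_D n \<le> ?b * real n"
    using chebyshev_D_eventually[OF assms] unfolding eventually_sequentially
    by (fastforce simp: algebra_simps)
  define C where "C = Max (chebyshev_psi ` {..n0})"
  have b: "?b > 0"
    using chebyshev_const_pos assms by simp
  have "chebyshev_psi n \<le> 6/5 * ?b * real n + C" for n
  proof (induction n rule: less_induct)
    case (less n)
    show ?case
    proof (cases "n \<le> n0")
      case True
      then have "chebyshev_psi n \<le> C"
        unfolding C_def by (intro Max_ge) auto
      then show ?thesis
        using b by (simp add: add_increasing)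
    next
      case False
      then have "chebyshev_psi (n div 6) \<le> 6/5 * ?b * real (n div 6) + C"
        by (intro less) auto
      moreover have "6/5 * ?b * real (n div 6) \<le> 6/5 * ?b * (real n / 6)"
        using b of_nat_div_le_of_nat[of n 6, where ?'a = real] by (intro mult_left_mono) auto
      ultimately have "chebyshev_psi (n div 6) \<le> 1/5 * ?b * real n + C"
        by (simp add: field_simps)
      then show ?thesis
        using psi_diff_le_chebyshev_D[of n] n0[of n] False by (simp add: field_simps)
    qed
  qed
  then show ?thesis
    using that by blast
qed

text \<open>Only powers \<open>p ^ k\<close> with \<open>k \<ge> 2\<close> can contribute. Then
  \<open>p \<le> sqrt N\<close> and \<open>k \<le> 2 * ln N\<close>, so there are few of them, each
  of weight at most \<open>ln N\<close>.\<close>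

lemma psi_diff_le_if_no_primes:
  assumes "M \<le> N" "N \<ge> 1" "\<And>p. prime p \<Longrightarrow> \<not> (M < p \<and> p \<le> N)"
  shows "chebyshev_psi N - chebyshev_psi M \<le> sqrt (real N) * (2 * ln (real N)) * ln (real N)"
proof -
  define A where "A = {d\<in>{M<..N}. primepow d}"
  define B where "B = {1..nat \<lfloor>sqrt (real N)\<rfloor>} \<times> {1..nat \<lfloor>2 * ln (real N)\<rfloor>}"
  have "chebyshev_psi N = chebyshev_psi M + (\<Sum>d\<in>{M<..N}. mangoldt d)"
    unfolding chebyshev_psi_def using assms(1)
    by (subst sum.union_disjoint[symmetric]) (auto intro!: sum.cong)
  also have "(\<Sum>d\<in>{M<..N}. mangoldt d) = (\<Sum>d\<in>A. mangoldt d :: real)"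
    unfolding A_def by (intro sum.mono_neutral_right) (auto simp: mangoldt_def)
  also have "\<dots> \<le> (\<Sum>d\<in>A. ln (real N))"
  proof (intro sum_mono)
    fix d assume d: "d \<in> A"
    then have "mangoldt d \<le> ln (real d)"
      by (intro mangoldt_le) (auto simp: A_def)
    also have "\<dots> \<le> ln (real N)"
      using d by (auto simp: A_def)
    finally show "mangoldt d \<le> ln (real N)" .
  qed
  also have "\<dots> = real (card A) * ln (real N)"
    by simp
  also have "\<dots> \<le> sqrt (real N) * (2 * ln (real N)) * ln (real N)"
  proof (intro mult_right_mono)
    have "A \<subseteq> (\<lambda>(p, k). p ^ k) ` B"
    proof
      fix d assume d: "d \<in> A"
      then obtain p k where pk: "prime p" "k > 0" "d = p ^ k"
        by (auto simp: A_def primepow_def)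
      have dN: "M < p ^ k" "p ^ k \<le> N"
        using d pk by (auto simp: A_def)
      have "k \<noteq> 1"
        using assms(3)[OF pk(1)] dN by auto
      then have "k \<ge> 2"
        using pk by simp
      have p: "p \<ge> 2"
        using pk prime_ge_2_nat by blast
      have "p ^ 2 \<le> p ^ k"
        using \<open>k \<ge> 2\<close> p by (intro power_increasing) auto
      then have "real p ^ 2 \<le> real N"
        using dN by (metis of_nat_le_iff of_nat_power order_trans)
      then have "real p \<le> sqrt (real N)"
        by (rule real_le_rsqrt)
      moreover have "real k \<le> 2 * ln (real N)"
      proof -
        have "(2::nat) ^ k \<le> p ^ k"
          using p by (intro power_mono) auto
        then have "(2::real) ^ k \<le> real N"
          using dN by (metis of_nat_le_iff of_nat_numeral of_nat_power order_trans)
        then have "ln ((2::real) ^ k) \<le> ln (real N)"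
          using assms(2) by simp
        then have "real k * ln 2 \<le> ln (real N)"
          by (simp add: ln_realpow)
        moreover have "real k * (1/2) \<le> real k * ln 2"
          using ln2_ge_two_thirds by (intro mult_left_mono) auto
        ultimately show ?thesis
          by linarith
      qed
      ultimately have "(p, k) \<in> B"
        using p pk by (auto simp: B_def le_nat_floor)
      then show "d \<in> (\<lambda>(p, k). p ^ k) ` B"
        using pk by force
    qed
    then have "card A \<le> card B"
      by (rule surj_card_le[rotated]) (simp add: B_def)
    also have "real (card B) \<le> sqrt (real N) * (2 * ln (real N))"
      unfolding B_def card_cartesian_product of_nat_mult
      using assms(2) by (intro mult_mono) auto
    finally show "real (card A) \<le> sqrt (real N) * (2 * ln (real N))"
      by simp
  qed (use assms in auto)
  finally show ?thesis
    by simp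
qed

text \<open>Up to lower order terms, \<open>chebyshev_psi\<close> is at least
  \<open>A * b * r\<close> at \<open>b * r\<close> and at most \<open>6/5 * A * a * r\<close> at
  \<open>a * r\<close>. The difference thus grows linearly, which is impossible if no prime lies
  between.\<close>

lemma prime_in_interval:
  fixes a b :: real
  assumes "a > 0" "b > 6/5 * a"
  shows "\<forall>\<^sub>F r::nat in sequentially. \<exists>p. prime p \<and> a * real r < real p \<and> real p \<le> b * real r"
proof -
  define A where "A = chebyshev_const"
  have A: "A > 0"
    by (simp add: A_def chebyshev_const_pos)
  \<comment> \<open>The total loss \<open>e * (b + 6/5 * a)\<close> is made half of the gain
    \<open>A * (b - 6/5 * a)\<close>; the other half is \<open>\<delta>\<close>.\<close>
  define e where "e = A * (b - 6/5 * a) / (2 * (b + 6/5 * a))"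
  have e: "e > 0"
    using assms A by (simp add: e_def)
  define \<delta> where "\<delta> = (A - e) * b - 6/5 * (A + e) * a"
  have "e * (b + 6/5 * a) = A * (b - 6/5 * a) / 2"
    using assms by (simp add: e_def field_simps)
  then have "\<delta> = A * (b - 6/5 * a) / 2"
    by (simp add: \<delta>_def field_simps)
  moreover have "A * (b - 6/5 * a) > 0"
    using A assms by simp
  ultimately have \<delta>: "\<delta> > 0"
    by (metis half_gt_zero)
  obtain C where C: "\<And>n. chebyshev_psi n \<le> 6/5 * (A + e) * real n + C"
    using psi_upper[OF e] unfolding A_def by blast
  define N where "N = (\<lambda>r::nat. nat \<lfloor>b * real r\<rfloor>)"
  define M where "M = (\<lambda>r::nat. nat \<lfloor>a * real r\<rfloor>)"
  have N: "real (N r) \<le> b * real r" "b * real r - 1 \<le> real (N r)" for r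
    using assms unfolding N_def by (simp, linarith)
  have M: "real (M r) \<le> a * real r" for r
    using assms unfolding M_def by simp
  have "filterlim N at_top sequentially"
    unfolding N_def using assms by real_asymp
  then have "\<forall>\<^sub>F r in sequentially. \<bar>chebyshev_D (N r) - A * real (N r)\<bar> \<le> e * real (N r)"
    unfolding A_def by (rule eventually_compose_filterlim[OF chebyshev_D_eventually[OF e]])
  moreover have "\<forall>\<^sub>F r::nat in sequentially.
      sqrt (b * real r) * (2 * ln (b * real r)) * ln (b * real r) + \<bar>C\<bar> + A < \<delta> * real r"
    using \<delta> assms by real_asymp
  moreover have "\<forall>\<^sub>F r::nat in sequentially. b * real r \<ge> 2"
    using assms by real_asymp
  ultimately show ?thesis
  proof eventually_elim
    case (elim r)
    show ?case
    proof (rule ccontr)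
      assume no: "\<not> ?thesis"
      have N1: "N r \<ge> 1"
        using N[of r] elim(3) by linarith
      have "M r \<le> N r"
        unfolding M_def N_def using assms by (intro nat_mono floor_mono mult_right_mono) auto
      moreover have "\<not> (M r < p \<and> p \<le> N r)" if "prime p" for p
      proof
        assume p: "M r < p \<and> p \<le> N r"
        then have "a * real r < real p"
          unfolding M_def using assms by linarith
        moreover have "real p \<le> b * real r"
          using p N(1)[of r] by linarith
        ultimately show False
          using no that by blast
      qed
      ultimately have "chebyshev_psi (N r) - chebyshev_psi (M r) \<le> sqrt (real (N r)) * (2 * ln (real (N r))) * ln (real (N r))"
        using N1 by (intro psi_diff_le_if_no_primes)
      also have "\<dots> \<le> sqrt (b * real r) * (2 * ln (b * real r)) * ln (b * real r)"
        using N[of r] N1 by (intro mult_mono) auto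
      finally have "chebyshev_psi (N r) - chebyshev_psi (M r) < \<delta> * real r - \<bar>C\<bar> - A"
        using elim(2) by linarith
      moreover have "chebyshev_psi (M r) \<le> 6/5 * (A + e) * (a * real r) + \<bar>C\<bar>"
      proof -
        have "6/5 * (A + e) * real (M r) \<le> 6/5 * (A + e) * (a * real r)"
          using M[of r] A e by (intro mult_left_mono) auto
        then show ?thesis
          using C[of "M r"] by linarith
      qed
      \<comment> \<open>The extra \<open>A\<close> pays for rounding \<open>b * real r\<close> down
        to \<open>N r\<close>.\<close>
      moreover have "(A - e) * (b * real r) - A \<le> chebyshev_psi (N r)"
      proof -
        have "e * (b + 6/5 * a) \<le> A * (b + 6/5 * a)"
          using assms A by (simp add: e_def field_simps)
        then have "e \<le> A"
          using assms by (simp add: mult_le_cancel_right)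
        then have "(A - e) * (b * real r - 1) \<le> (A - e) * real (N r)"
          using N[of r] by (intro mult_left_mono) auto
        moreover have "(A - e) * real (N r) \<le> chebyshev_D (N r)"
          using elim(1) by (simp add: algebra_simps)
        ultimately show ?thesis
          using chebyshev_D_le_psi[of "N r"] e by (simp add: algebra_simps)
      qed
      ultimately show False
        unfolding \<delta>_def by (simp add: algebra_simps)
    qed
  qed
qed

section \<open>Numerical bounds\<close>

text \<open>The area below the unit circle over the interval from 0 to \<open>x\<close>.\<close>

definition circ_area :: "real \<Rightarrow> real" where
  "circ_area x = (x * sqrt (1 - x\<^sup>2) + arcsin x) / 2"

lemma circ_area_simps [simp]: "circ_area 0 = 0" "circ_area 1 = pi / 4"
  by (simp_all add: circ_area_def)

lemma DERIV_circ_area: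
  assumes "-1 < x" "x < 1"
  shows "(circ_area has_real_derivative sqrt (1 - x\<^sup>2)) (at x)"
proof -
  have "x\<^sup>2 < 1"
    using assms by (simp add: abs_square_less_1)
  then have *: "sqrt (1 - x\<^sup>2) > 0" "sqrt (1 - x\<^sup>2) ^ 2 = 1 - x\<^sup>2"
    by simp_all
  have "((\<lambda>x. (x * sqrt (1 - x\<^sup>2) + arcsin x) / 2) has_real_derivative
     (sqrt (1 - x\<^sup>2) + x * (inverse (sqrt (1 - x\<^sup>2)) / 2 * (- (2 * x))) + inverse (sqrt (1 - x\<^sup>2))) / 2) (at x)"
    using assms * by (auto intro!: derivative_eq_intros simp: field_simps)
  moreover have "(sqrt (1 - x\<^sup>2) + x * (inverse (sqrt (1 - x\<^sup>2)) / 2 * (- (2 * x))) + inverse (sqrt (1 - x\<^sup>2))) / 2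
      = sqrt (1 - x\<^sup>2)"
    using * by (simp add: field_simps power2_eq_square)
  ultimately show ?thesis
    unfolding circ_area_def[abs_def] by metis
qed

lemma continuous_on_circ_area: "continuous_on {-1..1} circ_area"
  unfolding circ_area_def[abs_def] by (intro continuous_intros) auto

text \<open>Mean value theorem, the derivative being decreasing on the interval from 0 to 1. This
  serves as Riemann sum comparison when counting lattice points and as concavity in the numerical
  estimates.\<close>

lemma circ_area_diff_bounds:
  assumes "0 \<le> x" "x \<le> y" "y \<le> 1"
  shows "(y - x) * sqrt (1 - y\<^sup>2) \<le> circ_area y - circ_area x"
    and "circ_area y - circ_area x \<le> (y - x) * sqrt (1 - x\<^sup>2)"
proof -
  have "(y - x) * sqrt (1 - y\<^sup>2) \<le> circ_area y - circ_area x \<and>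
        circ_area y - circ_area x \<le> (y - x) * sqrt (1 - x\<^sup>2)"
  proof (cases "x = y")
    case False
    then have "x < y"
      using assms by simp
    moreover have "continuous_on {x..y} circ_area"
      by (rule continuous_on_subset[OF continuous_on_circ_area]) (use assms in auto)
    moreover have "circ_area differentiable (at z)" if "x < z" "z < y" for z
      using DERIV_circ_area[of z] that assms by (auto simp: real_differentiable_def)
    ultimately obtain l z where z: "x < z" "z < y" "(circ_area has_real_derivative l) (at z)"
        "circ_area y - circ_area x = (y - x) * l"
      using MVT[of x y circ_area] by blast
    have "l = sqrt (1 - z\<^sup>2)"
      using DERIV_unique[OF z(3) DERIV_circ_area] z assms by simp
    moreover have "z\<^sup>2 \<le> y\<^sup>2" "x\<^sup>2 \<le> z\<^sup>2"
      using z assms by (auto intro!: power_mono)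
    ultimately show ?thesis
      using z assms by (auto intro!: mult_left_mono)
  qed auto
  then show "(y - x) * sqrt (1 - y\<^sup>2) \<le> circ_area y - circ_area x"
    "circ_area y - circ_area x \<le> (y - x) * sqrt (1 - x\<^sup>2)" by auto
qed

section \<open>Rational bounds for \<open>arcsin\<close>, \<open>mu\<close> and the truncated
  disc\<close>

lemma sin_Maclaurin_13:
  fixes x :: real
  shows "\<bar>sin x - (x - x ^ 3 / 6 + x ^ 5 / 120 - x ^ 7 / 5040 + x ^ 9 / 362880 - x ^ 11 / 39916800)\<bar>
    \<le> \<bar>x\<bar> ^ 13 / 6227020800"
proof -
  have "(\<Sum>m<13. sin_coeff m * x ^ m)
      = x - x ^ 3 / 6 + x ^ 5 / 120 - x ^ 7 / 5040 + x ^ 9 / 362880 - x ^ 11 / 39916800"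
    by (simp add: lessThan_nat_numeral sin_coeff_def fact_numeral)
  then show ?thesis
    using Maclaurin_sin_bound[of x 13] by (simp add: fact_numeral)
qed

lemma arcsin_404125_ge: "0.4159 \<le> arcsin 0.404125"
proof -
  have "sin 0.4159 \<le> (0.404125::real)"
    using sin_Maclaurin_13[of "0.4159"] unfolding abs_le_iff by (simp add: power_divide)
  moreover have "arcsin (sin 0.4159) = (0.4159::real)"
    using pi_gt3 by (intro arcsin_sin) auto
  ultimately show ?thesis
    using arcsin_le_arcsin[of "sin 0.4159" "0.404125"] by simp
qed

lemma arcsin_869_ge: "1.0531 \<le> arcsin 0.869"
proof -
  have "sin 1.0531 \<le> (0.869::real)"
    using sin_Maclaurin_13[of "1.0531"] unfolding abs_le_iff by (simp add: power_divide)
  moreover have "arcsin (sin 1.0531) = (1.0531::real)"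
    using pi_gt3 by (intro arcsin_sin) auto
  ultimately show ?thesis
    using arcsin_le_arcsin[of "sin 1.0531" "0.869"] by simp
qed

text \<open>After clearing \<open>cos t\<close> the claim is \<open>k t \<ge> 0\<close>. The
  derivative of \<open>k\<close> is \<open>4 * sin t * (sin t - s)\<close>, so on the interval
  \<open>k\<close> is smallest at \<open>t0 = arcsin s\<close> and a single value has to be
  estimated.\<close>

lemma mu_le: "mu \<le> 1.6165"
proof -
  \<comment> \<open>This is 1.6165 / 4, so that \<open>4 * s * cos t\<close> is the claimed bound
    times \<open>cos t\<close>.\<close>
  define s :: real where "s = 0.404125"
  define k where "k = (\<lambda>t::real. 4 * s * cos t - pi / 2 + 2 * t - sin (2 * t))"
  define t0 where "t0 = arcsin s"
  have s: "sin t0 = s"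
    by (simp add: t0_def s_def)
  have t0: "0 \<le> t0" "t0 \<le> pi / 2"
    unfolding t0_def s_def using arcsin_bounded[of "0.404125"] arcsin_404125_ge by auto
  have "0.9147 \<le> cos t0"
    unfolding t0_def s_def
    by (subst cos_arcsin, simp, simp, intro real_le_rsqrt) (simp add: power2_eq_square)
  then have "k t0 \<ge> 0"
    using arcsin_404125_ge pi_approx s
    by (simp add: k_def sin_double s_def t0_def)
  have deriv: "(k has_real_derivative 4 * sin t * (sin t - s)) (at t)" for t
  proof -
    have "(k has_real_derivative 4 * s * (- sin t) + 2 - cos (2 * t) * 2) (at t)"
      unfolding k_def by (auto intro!: derivative_eq_intros)
    moreover have "4 * s * (- sin t) + 2 - cos (2 * t) * 2 = 4 * sin t * (sin t - s)"
      using cos_double_sin[of t] by (simp add: power2_eq_square algebra_simps)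
    ultimately show ?thesis by simp
  qed
  have k: "k t \<ge> 0" if t: "0 \<le> t" "t \<le> pi / 4" for t
  proof (cases "t \<le> t0")
    case True
    have "k t0 \<le> k t"
    proof (rule DERIV_nonpos_imp_nonincreasing[OF True])
      fix x assume x: "t \<le> x" "x \<le> t0"
      then have "0 \<le> sin x" "sin x \<le> sin t0"
        using t t0 by (auto intro!: sin_ge_zero sin_monotone_2pi_le)
      then show "\<exists>y. (k has_real_derivative y) (at x) \<and> y \<le> 0"
        using deriv[of x] s by (auto intro!: exI mult_nonneg_nonpos)
    qed
    then show ?thesis
      using \<open>k t0 \<ge> 0\<close> by simp
  next
    case False
    then have "t0 \<le> t" by simp
    then have "k t0 \<le> k t"
    proof (rule DERIV_nonneg_imp_nondecreasing)
      fix x assume x: "t0 \<le> x" "x \<le> t"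
      then have "0 \<le> sin x" "sin t0 \<le> sin x"
        using t t0 by (auto intro!: sin_ge_zero sin_monotone_2pi_le)
      then show "\<exists>y. (k has_real_derivative y) (at x) \<and> 0 \<le> y"
        using deriv[of x] s by (auto intro!: exI mult_nonneg_nonneg)
    qed
    then show ?thesis
      using \<open>k t0 \<ge> 0\<close> by simp
  qed
  obtain t where t: "t \<in> {0..pi/4}" "mu_fun t = mu"
    using mu_attained by blast
  then have "0 \<le> t" "t \<le> pi / 4"
    by auto
  then have "cos t > 0"
    using pi_gt_zero by (intro cos_gt_zero_pi) linarith+
  moreover have "pi / 2 - 2 * t + sin (2 * t) \<le> 1.6165 * cos t"
    using k[OF \<open>0 \<le> t\<close> \<open>t \<le> pi / 4\<close>] by (simp add: k_def s_def)
  ultimately have "mu_fun t \<le> 1.6165"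
    unfolding mu_fun_def by (subst pos_divide_le_eq)
  then show ?thesis
    using t by simp
qed

text \<open>Up to the factor \<open>(real r)\<^sup>2 / sqrt 3\<close>, the right side counts the
  truncated disc for \<open>p = h * r\<close>. The function \<open>G\<close> is concave, so checking
  0.869 and 1 suffices; the margin at 0.869 is small.\<close>

lemma hexagon_area_bound:
  fixes h K :: real
  assumes "0.869 \<le> h" "h \<le> 1" "K \<le> 1.50433"
  shows "K * h \<le> 6 * circ_area h - pi"
proof -
  define G where "G = (\<lambda>x. 6 * circ_area x - K * x)"
  have "pi \<le> G 0.869"
  proof -
    have "0.4948 \<le> sqrt (1 - (0.869::real)\<^sup>2)"
      by (rule real_le_rsqrt) (simp add: power2_eq_square)
    then have "0.869 * 0.4948 + 1.0531 \<le> 2 * circ_area 0.869"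
      using arcsin_869_ge by (simp add: circ_area_def)
    then show ?thesis
      using pi_approx assms by (simp add: G_def)
  qed
  moreover have "pi \<le> G 1"
    using pi_approx assms by (simp add: G_def)
  \<comment> \<open>The cases are the sign of the derivative of \<open>G\<close> at
    \<open>h\<close>: if it is nonnegative, \<open>h\<close> is compared with 0.869, otherwise with
    1.\<close>
  ultimately have "pi \<le> G h"
  proof (cases "K / 6 \<le> sqrt (1 - h\<^sup>2)")
    case True
    then have "(h - 0.869) * (K / 6) \<le> (h - 0.869) * sqrt (1 - h\<^sup>2)"
      using assms by (intro mult_left_mono) auto
    also have "\<dots> \<le> circ_area h - circ_area 0.869"
      using assms by (intro circ_area_diff_bounds) auto
    finally show ?thesis
      using \<open>pi \<le> G 0.869\<close> by (simp add: G_def algebra_simps)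
  next
    case False
    have "circ_area 1 - circ_area h \<le> (1 - h) * sqrt (1 - h\<^sup>2)"
      using assms by (intro circ_area_diff_bounds) auto
    also have "\<dots> \<le> (1 - h) * (K / 6)"
      using assms False by (intro mult_left_mono) auto
    finally show ?thesis
      using \<open>pi \<le> G 1\<close> by (simp add: G_def algebra_simps)
  qed
  then show ?thesis
    by (simp add: G_def)
qed

text \<open>The left side is the \<open>K\<close> for which
  \<open>(real r)\<^sup>2 / sqrt 3 * (K * h)\<close> cell points, divided by
  \<open>p = h * r\<close>, give \<open>sqrt (2 / sqrt 3) * 1.6165 * (r / 2)\<close> dots.\<close>

lemma hexagon_constant_le: "sqrt 3 / 2 * (sqrt (2 / sqrt 3) * 1.6165) \<le> 1.50433"
proof -
  have 3: "1.73205 \<le> sqrt (3::real)" "sqrt (3::real) \<le> 1.73205081"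
    by (rule real_le_rsqrt, simp add: power2_eq_square) (rule real_le_lsqrt, simp_all add: power2_eq_square)
  have "sqrt 3 * sqrt (2 / sqrt 3) = sqrt (2 * sqrt 3)"
    by (simp add: real_sqrt_mult[symmetric] real_div_sqrt field_simps)
  also have "\<dots> \<le> 1.86121"
    using 3 by (intro real_le_lsqrt) (auto simp: power2_eq_square)
  finally show ?thesis by simp
qed

section \<open>Lattice points in the truncated hexagon\<close>

text \<open>The grid point with coordinates \<open>(i, j)\<close> has squared norm \<open>((2 i - j)\<^sup>2 + 3 j\<^sup>2) / 4\<close>.\<close>

definition hex_disc :: "nat \<Rightarrow> (int \<times> int) set" where
  "hex_disc r = {(i, j). (2 * i - j)\<^sup>2 + 3 * j\<^sup>2 \<le> (int r)\<^sup>2}"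

text \<open>The slice \<open>2 * i - j = s\<close> of \<open>hex_disc r\<close>, parametrised by
  \<open>i\<close> through \<open>j = 2 * i - s\<close>. In this direction half-plane cuts are
  unions of whole slices.\<close>

definition hex_row :: "nat \<Rightarrow> int \<Rightarrow> int set" where
  "hex_row r s = {i. s\<^sup>2 + 3 * (2 * i - s)\<^sup>2 \<le> (int r)\<^sup>2}"

text \<open>For \<open>\<bar>s\<bar> \<le> int r\<close>, the length of the real interval whose
  integers form \<open>hex_row r s\<close>.\<close>

definition row_width :: "nat \<Rightarrow> int \<Rightarrow> real" where
  "row_width r s = sqrt (((real r)\<^sup>2 - (real_of_int s)\<^sup>2) / 3)"

lemma hex_row_eq: "hex_row r s = {\<lceil>(s - row_width r s) / 2\<rceil>..\<lfloor>(s + row_width r s) / 2\<rfloor>}"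
proof -
  have "i \<in> hex_row r s \<longleftrightarrow> \<bar>2 * real_of_int i - s\<bar> \<le> row_width r s" for i
  proof -
    have "i \<in> hex_row r s \<longleftrightarrow>
        real_of_int (s\<^sup>2 + 3 * (2 * i - s)\<^sup>2) \<le> real_of_int ((int r)\<^sup>2)"
      unfolding hex_row_def of_int_le_iff by simp
    also have "\<dots> \<longleftrightarrow> (2 * real_of_int i - s)\<^sup>2 \<le> ((real r)\<^sup>2 - (real_of_int s)\<^sup>2) / 3"
      by (simp add: field_simps)
    \<comment> \<open>Since \<open>sqrt\<close> is increasing on all reals, this also covers
      \<open>\<bar>s\<bar> > int r\<close>: the width is then negative and the row empty.\<close>
    also have "\<dots> \<longleftrightarrow> sqrt ((2 * real_of_int i - s)\<^sup>2) \<le> row_width r s"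
      unfolding row_width_def by (rule real_sqrt_le_iff[symmetric])
    finally show ?thesis
      by simp
  qed
  moreover have "i \<in> {\<lceil>(s - w) / 2\<rceil>..\<lfloor>(s + w) / 2\<rfloor>} \<longleftrightarrow> \<bar>2 * real_of_int i - s\<bar> \<le> w"
    for i and w :: real
  proof -
    have "i \<in> {\<lceil>(s - w) / 2\<rceil>..\<lfloor>(s + w) / 2\<rfloor>} \<longleftrightarrow>
        (s - w) / 2 \<le> real_of_int i \<and> real_of_int i \<le> (s + w) / 2"
      by (simp only: atLeastAtMost_iff ceiling_le_iff le_floor_iff)
    also have "\<dots> \<longleftrightarrow> \<bar>2 * real_of_int i - s\<bar> \<le> w"
      by (auto simp: abs_le_iff field_simps)
    finally show ?thesis .
  qed
  ultimately show ?thesis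
    by blast
qed

lemma card_hex_row_bounds:
  assumes "\<bar>s\<bar> \<le> int r"
  shows "row_width r s - 1 \<le> real (card (hex_row r s))"
    and "real (card (hex_row r s)) \<le> row_width r s + 1"
proof -
  have "\<bar>real_of_int s\<bar> \<le> real r"
    using assms by linarith
  then have "(real_of_int s)\<^sup>2 \<le> (real r)\<^sup>2"
    by (simp add: abs_le_square_iff[symmetric])
  then have w: "row_width r s \<ge> 0"
    by (simp add: row_width_def)
  define a b where "a = \<lceil>(s - row_width r s) / 2\<rceil>" and "b = \<lfloor>(s + row_width r s) / 2\<rfloor>"
  have card: "card (hex_row r s) = nat (b - a + 1)"
    unfolding hex_row_eq a_def b_def by simp
  have "real_of_int a < (s - row_width r s) / 2 + 1" "(s - row_width r s) / 2 \<le> real_of_int a"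
       "(s + row_width r s) / 2 - 1 < real_of_int b" "real_of_int b \<le> (s + row_width r s) / 2"
    unfolding a_def b_def by linarith+
  then have "row_width r s - 1 \<le> real_of_int (b - a + 1)" "real_of_int (b - a + 1) \<le> row_width r s + 1"
    by (simp_all add: field_simps)
  then show "row_width r s - 1 \<le> real (card (hex_row r s))"
    and "real (card (hex_row r s)) \<le> row_width r s + 1"
    unfolding card using w by linarith+
qed

lemma finite_hex_row: "finite (hex_row r s)"
  by (simp add: hex_row_eq)

lemma half_disc_eq:
  "{(i, j) \<in> hex_disc r. a \<le> 2 * i - j} = (\<lambda>(s, i). (i, 2 * i - s)) ` Sigma {a..int r} (hex_row r)"
proof (intro equalityI subsetI)
  fix x assume "x \<in> {(i, j) \<in> hex_disc r. a \<le> 2 * i - j}"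
  then obtain i j where x: "x = (i, j)" "(2 * i - j)\<^sup>2 + 3 * j\<^sup>2 \<le> (int r)\<^sup>2" "a \<le> 2 * i - j"
    by (auto simp: hex_disc_def)
  then have "(2 * i - j)\<^sup>2 \<le> (int r)\<^sup>2"
    using zero_le_power2[of j] by linarith
  then have "2 * i - j \<le> int r"
    by (rule power2_le_imp_le) simp
  then have "(2 * i - j, i) \<in> Sigma {a..int r} (hex_row r)"
    using x by (simp add: hex_row_def)
  then show "x \<in> (\<lambda>(s, i). (i, 2 * i - s)) ` Sigma {a..int r} (hex_row r)"
    using x by (intro image_eqI[of _ _ "(2 * i - j, i)"]) auto
qed (auto simp: hex_disc_def hex_row_def)

lemma finite_half_disc: "finite {(i, j) \<in> hex_disc r. a \<le> 2 * i - j}"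
  unfolding half_disc_eq by (intro finite_imageI finite_SigmaI finite_hex_row) simp

lemma card_half_disc:
  "card {(i, j) \<in> hex_disc r. int a \<le> 2 * i - j} = (\<Sum>k=a..r. card (hex_row r (int k)))"
proof -
  have "inj_on (\<lambda>(s, i). (i, 2 * i - s)) (Sigma {int a..int r} (hex_row r))"
    by (auto simp: inj_on_def)
  then have "card {(i, j) \<in> hex_disc r. int a \<le> 2 * i - j} = card (Sigma {int a..int r} (hex_row r))"
    unfolding half_disc_eq by (rule card_image)
  also have "\<dots> = (\<Sum>s=int a..int r. card (hex_row r s))"
    by (simp add: finite_hex_row)
  also have "\<dots> = (\<Sum>s\<in>int ` {a..r}. card (hex_row r s))"
    by (simp add: image_int_atLeastAtMost)
  also have "\<dots> = (\<Sum>k=a..r. card (hex_row r (int k)))"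
    by (subst sum.reindex) (auto simp: inj_on_def)
  finally show ?thesis .
qed

lemma row_width_eq:
  assumes "r > 0"
  shows "row_width r (int k) = real r / sqrt 3 * sqrt (1 - (real k / real r)\<^sup>2)"
proof -
  have "((real r)\<^sup>2 - (real k)\<^sup>2) / 3 = (real r)\<^sup>2 / 3 * (1 - (real k / real r)\<^sup>2)"
    using assms by (simp add: field_simps)
  then show ?thesis
    unfolding row_width_def of_int_of_nat_eq by (simp only: real_sqrt_mult real_sqrt_divide) simp
qed

text \<open>\<open>A\<close> telescopes into increments of \<open>circ_area\<close>, each lying
  between the widths of two neighbouring rows. A row holds as many points as its width, up to 1, so
  the total error is linear in \<open>r\<close>.\<close>

lemma card_half_disc_bounds:
  assumes "r > 0" "a \<le> r"
  defines "n \<equiv> real (card {(i, j) \<in> hex_disc r. int a \<le> 2 * i - j})"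
    and "A \<equiv> (real r)\<^sup>2 / sqrt 3 * (pi / 4 - circ_area (real a / real r))"
  shows "A - (real r + 1) \<le> n" and "n \<le> A + 2 * real r + 1"
proof -
  define c where "c = (\<lambda>k. (real r)\<^sup>2 / sqrt 3 * circ_area (real k / real r))"
  have "c r - c a = A"
    using assms(1) by (simp add: c_def A_def right_diff_distrib)
  then have tele: "(\<Sum>k=a..<r. c (Suc k) - c k) = A"
    using sum_Suc_diff'[OF assms(2), of c] by simp
  have step: "row_width r (int (Suc k)) \<le> c (Suc k) - c k" "c (Suc k) - c k \<le> row_width r (int k)"
    if "k < r" for k
  proof -
    have *: "0 \<le> real k / real r" "real k / real r \<le> real (Suc k) / real r" "real (Suc k) / real r \<le> 1"
      using that by (auto simp: field_simps)
    have d: "real (Suc k) / real r - real k / real r = 1 / real r"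
      by (simp add: diff_divide_distrib[symmetric])
    have eq: "(real r)\<^sup>2 / sqrt 3 * (1 / real r * x) = real r / sqrt 3 * x" for x
      using assms(1) by (simp add: power2_eq_square)
    show "row_width r (int (Suc k)) \<le> c (Suc k) - c k"
      unfolding row_width_eq[OF assms(1)] c_def right_diff_distrib[symmetric] eq[symmetric] d[symmetric]
      by (intro mult_left_mono circ_area_diff_bounds *) simp
    show "c (Suc k) - c k \<le> row_width r (int k)"
      unfolding row_width_eq[OF assms(1)] c_def right_diff_distrib[symmetric] eq[symmetric] d[symmetric]
      by (intro mult_left_mono circ_area_diff_bounds *) simp
  qed
  have width: "0 \<le> row_width r (int k)" "row_width r (int k) \<le> real r" if "k \<le> r" for k
  proof -
    have "(real k)\<^sup>2 \<le> (real r)\<^sup>2"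
      using that by (intro power_mono) auto
    then show "0 \<le> row_width r (int k)"
      by (simp add: row_width_def)
    have "row_width r (int k) \<le> sqrt ((real r)\<^sup>2)"
      unfolding row_width_def by (intro real_sqrt_le_mono) (simp add: field_simps)
    then show "row_width r (int k) \<le> real r"
      by simp
  qed
  have n: "n = (\<Sum>k=a..r. real (card (hex_row r (int k))))"
    by (simp add: n_def card_half_disc)
  have ones: "(\<Sum>k=a..r. 1::real) \<le> real r + 1"
    by simp
  show "A - (real r + 1) \<le> n"
  proof -
    have "A \<le> (\<Sum>k=a..<r. row_width r (int k))"
      unfolding tele[symmetric] by (intro sum_mono step) auto
    also have "\<dots> \<le> (\<Sum>k=a..r. row_width r (int k))"
      by (intro sum_mono2 width) auto
    also have "\<dots> - (\<Sum>k=a..r. 1) \<le> n"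
      unfolding n sum_subtractf[symmetric] by (intro sum_mono card_hex_row_bounds) auto
    finally show ?thesis
      using ones by linarith
  qed
  show "n \<le> A + 2 * real r + 1"
  proof -
    have "n \<le> (\<Sum>k=a..r. row_width r (int k) + 1)"
      unfolding n by (intro sum_mono card_hex_row_bounds) auto
    also have "\<dots> = (\<Sum>k=a..r. row_width r (int k)) + (\<Sum>k=a..r. 1)"
      by (rule sum.distrib)
    \<comment> \<open>The upper sum shifts by one row, so the first row is split off and bounded by
      \<open>real r\<close>.\<close>
    also have "(\<Sum>k=a..r. row_width r (int k)) = row_width r (int a) + (\<Sum>k=Suc a..r. row_width r (int k))"
      using assms(2) by (rule sum.atLeast_Suc_atMost)
    also have "(\<Sum>k=Suc a..r. row_width r (int k)) = (\<Sum>k=a..<r. row_width r (int (Suc k)))"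
      unfolding atLeastLessThanSuc_atLeastAtMost[symmetric] sum.shift_bounds_Suc_ivl ..
    also have "\<dots> \<le> A"
      unfolding tele[symmetric] by (intro sum_mono step) auto
    finally show ?thesis
      using ones width[OF assms(2)] by linarith
  qed
qed

text \<open>The disc of diameter \<open>r\<close> truncated by the Voronoi cell of \<open>p\<close> times the grid.\<close>

definition hex_cell :: "nat \<Rightarrow> nat \<Rightarrow> (int \<times> int) set" where
  "hex_cell p r = {(i, j) \<in> hex_disc r.
     \<bar>2 * i - j\<bar> < int p \<and> \<bar>2 * j - i\<bar> < int p \<and> \<bar>i + j\<bar> < int p}"

lemma finite_hex_disc: "finite (hex_disc r)"
proof -
  have eq: "hex_disc r = {(i, j) \<in> hex_disc r. - int r \<le> 2 * i - j}"
  proof -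
    have "- int r \<le> 2 * i - j" if "(i, j) \<in> hex_disc r" for i j
    proof -
      have "(j - 2 * i)\<^sup>2 \<le> (int r)\<^sup>2"
        using that zero_le_power2[of j] power2_commute[of "2 * i" j]
        unfolding hex_disc_def mem_Collect_eq prod.case by linarith
      then have "j - 2 * i \<le> int r"
        by (rule power2_le_imp_le) simp
      then show ?thesis
        by simp
    qed
    then show ?thesis
      by auto
  qed
  show ?thesis
    by (subst eq) (rule finite_half_disc)
qed

lemma finite_hex_cell: "finite (hex_cell p r)"
  by (rule finite_subset[OF _ finite_hex_disc[of r]]) (auto simp: hex_cell_def)

text \<open>These maps carry \<open>2 * i - j\<close> to \<open>j - 2 * i\<close>,
  \<open>2 * j - i\<close> and \<open>i + j\<close>, and so move one side of the hexagon to the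
  others.\<close>

lemma hex_disc_symmetries:
  "(- i, - j) \<in> hex_disc r \<longleftrightarrow> (i, j) \<in> hex_disc r"
  "(j, i) \<in> hex_disc r \<longleftrightarrow> (i, j) \<in> hex_disc r"
  "(i, i - j) \<in> hex_disc r \<longleftrightarrow> (i, j) \<in> hex_disc r"
proof -
  have "(2 * (- i) - (- j))\<^sup>2 + 3 * (- j)\<^sup>2 = (2 * i - j)\<^sup>2 + 3 * j\<^sup>2"
       "(2 * j - i)\<^sup>2 + 3 * i\<^sup>2 = (2 * i - j)\<^sup>2 + 3 * j\<^sup>2"
       "(2 * i - (i - j))\<^sup>2 + 3 * (i - j)\<^sup>2 = (2 * i - j)\<^sup>2 + 3 * j\<^sup>2"
    by (simp_all add: power2_eq_square algebra_simps)
  then show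
    "(- i, - j) \<in> hex_disc r \<longleftrightarrow> (i, j) \<in> hex_disc r"
    "(j, i) \<in> hex_disc r \<longleftrightarrow> (i, j) \<in> hex_disc r"
    "(i, i - j) \<in> hex_disc r \<longleftrightarrow> (i, j) \<in> hex_disc r"
    unfolding hex_disc_def mem_Collect_eq prod.case by simp_all
qed

text \<open>Inversion through the origin swaps the two open halves; the bounds 0 and 1 make the
  middle line count once.\<close>

lemma card_hex_disc:
  "card (hex_disc r) = card {(i, j) \<in> hex_disc r. 0 \<le> 2 * i - j} + card {(i, j) \<in> hex_disc r. 1 \<le> 2 * i - j}"
proof -
  let ?A = "{(i, j) \<in> hex_disc r. 0 \<le> 2 * i - j}" and ?B = "{(i, j) \<in> hex_disc r. 1 \<le> 2 * i - j}"
  have "hex_disc r = ?A \<union> (\<lambda>(i, j). (- i, - j)) ` ?B"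
  proof (intro equalityI subsetI)
    fix x assume x: "x \<in> hex_disc r"
    obtain i j where ij: "x = (i, j)"
      by force
    show "x \<in> ?A \<union> (\<lambda>(i, j). (- i, - j)) ` ?B"
      using x ij by (cases "0 \<le> 2 * i - j")
        (auto simp: hex_disc_symmetries intro!: image_eqI[of _ _ "(- i, - j)"])
  qed (auto simp: hex_disc_symmetries)
  moreover have "card (?A \<union> (\<lambda>(i, j). (- i, - j)) ` ?B) = card ?A + card ((\<lambda>(i, j). (- i, - j)) ` ?B)"
    using finite_half_disc[of r 0] finite_half_disc[of r 1]
    by (intro card_Un_disjoint finite_imageI) auto
  moreover have "card ((\<lambda>(i, j). (- i, - j)) ` ?B) = card ?B"
    by (intro card_image) (auto simp: inj_on_def)
  ultimately show ?thesis
    by simp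
qed

text \<open>A disc point outside the cell violates one of six inequalities, hence lies in one of six
  symmetric images of a single cap.\<close>

lemma card_hex_cell_ge:
  "card (hex_disc r) \<le> card (hex_cell p r) + 6 * card {(i, j) \<in> hex_disc r. int p \<le> 2 * i - j}"
proof -
  let ?S = "{(i, j) \<in> hex_disc r. int p \<le> 2 * i - j}"
  let ?n = "\<lambda>(i, j). (- i, - j) :: int \<times> int" and ?w = "\<lambda>(i, j). (j, i) :: int \<times> int"
    and ?u = "\<lambda>(i, j). (i, i - j) :: int \<times> int"
  let ?M = "{id, ?n, ?w, ?n \<circ> ?w, ?u, ?n \<circ> ?u}"
  have "hex_disc r \<subseteq> hex_cell p r \<union> (\<Union>f\<in>?M. f ` ?S)"
  proof
    fix x assume x: "x \<in> hex_disc r"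
    obtain i j where ij: "x = (i, j)"
      by force
    have sym: "(- i, - j) \<in> hex_disc r" "(j, i) \<in> hex_disc r" "(- j, - i) \<in> hex_disc r"
         "(i, i - j) \<in> hex_disc r" "(- i, j - i) \<in> hex_disc r"
      using x[unfolded ij] hex_disc_symmetries(1)[of i j r] hex_disc_symmetries(2)[of j i r]
        hex_disc_symmetries(1)[of j i r] hex_disc_symmetries(3)[of i j r]
        hex_disc_symmetries(1)[of i "i - j" r, unfolded minus_diff_eq] by blast+
    consider "x \<in> hex_cell p r" | "int p \<le> 2 * i - j" | "int p \<le> j - 2 * i" | "int p \<le> 2 * j - i"
      | "int p \<le> i - 2 * j" | "int p \<le> i + j" | "int p \<le> - i - j"
      using x by (fastforce simp: hex_cell_def ij)
    then show "x \<in> hex_cell p r \<union> (\<Union>f\<in>?M. f ` ?S)"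
    proof cases
      case 2
      then have "x \<in> id ` ?S" using x by (simp add: ij)
      then show ?thesis by blast
    next
      case 3
      then have "x \<in> ?n ` ?S" using sym by (intro image_eqI[of _ _ "(- i, - j)"]) (auto simp: ij)
      then show ?thesis by blast
    next
      case 4
      then have "x \<in> ?w ` ?S" using sym by (intro image_eqI[of _ _ "(j, i)"]) (auto simp: ij)
      then show ?thesis by blast
    next
      case 5
      then have "x \<in> (?n \<circ> ?w) ` ?S" using sym by (intro image_eqI[of _ _ "(- j, - i)"]) (auto simp: ij)
      then show ?thesis by blast
    next
      case 6
      then have "x \<in> ?u ` ?S" using sym by (intro image_eqI[of _ _ "(i, i - j)"]) (auto simp: ij)
      then show ?thesis by blast
    next
      case 7
      then have "x \<in> (?n \<circ> ?u) ` ?S" using sym by (intro image_eqI[of _ _ "(- i, j - i)"]) (auto simp: ij)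
      then show ?thesis by blast
    qed blast
  qed
  then have "card (hex_disc r) \<le> card (hex_cell p r \<union> (\<Union>f\<in>?M. f ` ?S))"
    using finite_hex_cell finite_half_disc by (intro card_mono) auto
  also have "\<dots> \<le> card (hex_cell p r) + card (\<Union>f\<in>?M. f ` ?S)"
    by (rule card_Un_le)
  also have "card (\<Union>f\<in>?M. f ` ?S) \<le> (\<Sum>f\<in>?M. card (f ` ?S))"
    by (rule card_UN_le) simp
  also have "\<dots> \<le> (\<Sum>f\<in>?M. card ?S)"
    by (intro sum_mono card_image_le finite_half_disc)
  also have "\<dots> = card ?M * card ?S"
    by simp
  also have "card ?M \<le> 6"
  proof -
    have "?M = set [id, ?n, ?w, ?n \<circ> ?w, ?u, ?n \<circ> ?u]"
      by (simp only: list.set)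
    also have "card \<dots> \<le> 6"
      by (rule order_trans[OF card_length]) simp
    finally show ?thesis .
  qed
  finally show ?thesis
    by simp
qed

text \<open>Disc minus six caps. The errors \<open>3 * r + 2\<close> for the disc and
  \<open>6 * (2 * r + 1)\<close> for the caps total at most \<open>23 * r\<close>. For
  \<open>p > r\<close> the caps are empty.\<close>

lemma card_hex_cell_bounds:
  assumes "r > 0"
  shows "p \<le> r \<Longrightarrow> (real r)\<^sup>2 / sqrt 3 * (6 * circ_area (real p / real r) - pi) - 23 * real r
           \<le> real (card (hex_cell p r))"
    and "p > r \<Longrightarrow> (real r)\<^sup>2 / sqrt 3 * (pi / 2) - 23 * real r \<le> real (card (hex_cell p r))"
proof -
  define B where "B = (real r)\<^sup>2 / sqrt 3"
  let ?S = "{(i, j) \<in> hex_disc r. int p \<le> 2 * i - j}"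
  have r: "real r \<ge> 1"
    using assms by simp
  \<comment> \<open>The second half of the disc starts at row 1; the missing strip costs at most
    \<open>real r\<close>.\<close>
  have "circ_area (1 / real r) \<le> 1 / real r"
    using circ_area_diff_bounds(2)[of 0 "1 / real r"] r by simp
  then have "B * circ_area (1 / real r) \<le> B * (1 / real r)"
    by (intro mult_left_mono) (auto simp: B_def)
  also have "\<dots> = real r / sqrt 3"
    using r by (simp add: B_def power2_eq_square)
  also have "\<dots> \<le> real r / 1"
    by (intro divide_left_mono) auto
  finally have "B * circ_area (1 / real r) \<le> real r"
    by simp
  then have disc: "B * (pi / 2) - (3 * real r + 2) \<le> real (card (hex_disc r))"
    using card_half_disc_bounds(1)[of r 0] card_half_disc_bounds(1)[of r 1] assms
    unfolding card_hex_disc B_def[symmetric] by (simp add: algebra_simps)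
  have cell: "real (card (hex_disc r)) \<le> real (card (hex_cell p r)) + 6 * real (card ?S)"
    using card_hex_cell_ge[of r p] by linarith
  {
    assume "p \<le> r"
    then have "real (card ?S) \<le> B * (pi / 4 - circ_area (real p / real r)) + 2 * real r + 1"
      using card_half_disc_bounds(2)[of r p] assms unfolding B_def by simp
    then have "6 * (B * circ_area (real p / real r)) - B * pi - 23 * real r \<le> real (card (hex_cell p r))"
      using disc cell r unfolding right_diff_distrib by linarith
    then have "B * (6 * circ_area (real p / real r) - pi) - 23 * real r \<le> real (card (hex_cell p r))"
      by (simp add: right_diff_distrib mult.left_commute)
    then show "(real r)\<^sup>2 / sqrt 3 * (6 * circ_area (real p / real r) - pi) - 23 * real r
        \<le> real (card (hex_cell p r))"
      by (simp add: B_def)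
  next
    assume "p > r"
    then have "card ?S = 0"
      using card_half_disc[of r p] by simp
    then show "(real r)\<^sup>2 / sqrt 3 * (pi / 2) - 23 * real r \<le> real (card (hex_cell p r))"
      using disc cell r unfolding B_def by linarith
  }
qed

section \<open>Residues modulo \<open>p\<close>: the cell and the parabola\<close>

text \<open>The difference of the points is \<open>p\<close> times some \<open>(u, v)\<close>, and
  the strict bounds leave \<open>2 * u - v\<close>, \<open>2 * v - u\<close> and
  \<open>u + v\<close> at most 1 in absolute value. As \<open>3 * u\<close> and \<open>3 * v\<close>
  are sums of two of these, both vanish.\<close>

lemma hex_cell_cong_imp_eq:
  assumes "(i, j) \<in> hex_cell p r" "(k, l) \<in> hex_cell p r" "[i = k] (mod int p)" "[j = l] (mod int p)"
  shows "i = k \<and> j = l"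
proof -
  obtain u v where uv: "i - k = int p * u" "j - l = int p * v"
    using assms(3,4) unfolding cong_iff_dvd_diff by (auto elim!: dvdE)
  have small: "\<bar>t\<bar> \<le> 1" if "\<bar>int p * t\<bar> < 2 * int p" for t
  proof (rule ccontr)
    assume "\<not> \<bar>t\<bar> \<le> 1"
    then have "int p * 2 \<le> int p * \<bar>t\<bar>"
      by (intro mult_left_mono) auto
    then show False
      using that by (simp add: abs_mult)
  qed
  have "int p * (2 * u - v) = (2 * i - j) - (2 * k - l)" "int p * (2 * v - u) = (2 * j - i) - (2 * l - k)"
       "int p * (u + v) = (i + j) - (k + l)"
    using uv by (simp_all add: algebra_simps)
  moreover have "\<bar>2 * i - j\<bar> < int p" "\<bar>2 * j - i\<bar> < int p" "\<bar>i + j\<bar> < int p"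
      "\<bar>2 * k - l\<bar> < int p" "\<bar>2 * l - k\<bar> < int p" "\<bar>k + l\<bar> < int p"
    using assms(1,2) by (simp_all add: hex_cell_def)
  ultimately have "\<bar>int p * (2 * u - v)\<bar> < 2 * int p" "\<bar>int p * (2 * v - u)\<bar> < 2 * int p"
      "\<bar>int p * (u + v)\<bar> < 2 * int p"
    by linarith+
  then have "\<bar>2 * u - v\<bar> \<le> 1" "\<bar>2 * v - u\<bar> \<le> 1" "\<bar>u + v\<bar> \<le> 1"
    by (blast intro: small)+
  then have "u = 0 \<and> v = 0"
    by presburger
  then show ?thesis
    using uv by simp
qed

text \<open>Pigeonhole: the translates for the \<open>p\<close> residues of \<open>c\<close> cover
  \<open>S\<close>.\<close>

lemma parabola_dense_translate:
  fixes S :: "(int \<times> int) set"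
  assumes "finite S" "p > 0"
  shows "\<exists>c. card S \<le> p * card {(i, j) \<in> S. [j + c = i\<^sup>2] (mod int p)}"
proof (rule ccontr)
  let ?T = "\<lambda>c. {(i, j) \<in> S. [j + c = i\<^sup>2] (mod int p)}"
  assume "\<not> ?thesis"
  then have less: "p * card (?T c) < card S" for c
    by (auto simp: not_le)
  have "S \<subseteq> (\<Union>c\<in>{0..<int p}. ?T c)"
  proof
    fix x assume x: "x \<in> S"
    obtain i j where ij: "x = (i, j)"
      by force
    have "[j + (i\<^sup>2 - j) mod int p = i\<^sup>2] (mod int p)"
      by (simp add: cong_def mod_add_right_eq)
    then have "x \<in> ?T ((i\<^sup>2 - j) mod int p)"
      using x ij by simp
    then show "x \<in> (\<Union>c\<in>{0..<int p}. ?T c)"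
      using assms(2) by (intro UN_I) auto
  qed
  then have "card S \<le> card (\<Union>c\<in>{0..<int p}. ?T c)"
    using assms(1) by (intro card_mono finite_UN_I) (auto intro: finite_subset)
  also have "\<dots> \<le> (\<Sum>c\<in>{0..<int p}. card (?T c))"
    by (rule card_UN_le) simp
  finally have "p * card S \<le> (\<Sum>c\<in>{0..<int p}. p * card (?T c))"
    by (simp add: sum_distrib_left[symmetric])
  also have "\<dots> < (\<Sum>c\<in>{0..<int p}. card S)"
    using assms(2) less by (intro sum_strict_mono) auto
  also have "\<dots> = p * card S"
    by simp
  finally show False
    by simp
qed

text \<open>The Sidon property of the parabola. Eliminating \<open>i4\<close> turns the congruence
  into \<open>p dvd 2 * ((i1 - i2) * (i1 - i3))\<close> with \<open>p\<close> an odd prime; second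
  coordinates follow since \<open>i\<close> determines \<open>j\<close> modulo
  \<open>p\<close>.\<close>

lemma parabola_differences:
  fixes p :: nat and i1 i2 i3 i4 :: int
  assumes "prime p" "p > 2"
    and "[j1 + c = i1\<^sup>2] (mod p)" "[j2 + c = i2\<^sup>2] (mod p)" "[j3 + c = i3\<^sup>2] (mod p)" "[j4 + c = i4\<^sup>2] (mod p)"
    and diff: "i1 - i2 = i3 - i4" "j1 - j2 = j3 - j4"
  shows "[i1 = i2] (mod p) \<and> [j1 = j2] (mod p) \<or> [i1 = i3] (mod p) \<and> [j1 = j3] (mod p)"
proof -
  have p: "prime (int p)"
    using assms(1) by simp
  have j: "[j = j'] (mod p)" if "[j + c = i\<^sup>2] (mod p)" "[j' + c = i'\<^sup>2] (mod p)" "[i = i'] (mod p)" for i i' j j'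
  proof -
    have "[i\<^sup>2 = i'\<^sup>2] (mod p)"
      using that(3) by (rule cong_pow)
    then have "[j + c = j' + c] (mod p)"
      using that(1,2) by (meson cong_sym cong_trans)
    then show ?thesis
      by (simp add: cong_add_rcancel)
  qed
  have "[(j1 + c) - (j2 + c) = i1\<^sup>2 - i2\<^sup>2] (mod p)" "[(j3 + c) - (j4 + c) = i3\<^sup>2 - i4\<^sup>2] (mod p)"
    by (rule cong_diff[OF assms(3,4)], rule cong_diff[OF assms(5,6)])
  then have "[i1\<^sup>2 - i2\<^sup>2 = i3\<^sup>2 - i4\<^sup>2] (mod p)"
    using diff by (simp add: cong_def)
  then have "int p dvd (i1\<^sup>2 - i2\<^sup>2) - (i3\<^sup>2 - i4\<^sup>2)"
    by (simp add: cong_iff_dvd_diff)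
  also have "(i1\<^sup>2 - i2\<^sup>2) - (i3\<^sup>2 - i4\<^sup>2) = 2 * ((i1 - i2) * (i1 - i3))"
  proof -
    have i4: "i4 = i3 - i1 + i2"
      using diff by simp
    show ?thesis
      unfolding i4 by (simp add: power2_eq_square algebra_simps)
  qed
  finally have "int p dvd 2 \<or> int p dvd i1 - i2 \<or> int p dvd i1 - i3"
    using p by (simp add: prime_dvd_mult_iff)
  moreover have "\<not> int p dvd 2"
    using assms(2) zdvd_imp_le[of "int p" 2] by auto
  ultimately have "[i1 = i2] (mod p) \<or> [i1 = i3] (mod p)"
    by (simp add: cong_iff_dvd_diff)
  then show ?thesis
    using j assms by blast
qed

section \<open>From coordinates to points of the plane\<close>

definition hex_point :: "int \<times> int \<Rightarrow> real ^ 2" where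
  "hex_point = (\<lambda>(i, j). of_int i *\<^sub>R vector [1, 0] + of_int j *\<^sub>R vector [- 1 / 2, sqrt 3 / 2])"

lemma hex_point_diff: "hex_point (i, j) - hex_point (k, l) = hex_point (i - k, j - l)"
  by (simp only: hex_point_def prod.case of_int_diff scaleR_left_diff_distrib add_diff_add)

lemma norm_hex_point: "(norm (hex_point (i, j)))\<^sup>2 = real_of_int ((2 * i - j)\<^sup>2 + 3 * j\<^sup>2) / 4"
proof -
  have "(norm (hex_point (i, j)))\<^sup>2 = (of_int i - of_int j / 2)\<^sup>2 + (of_int j * sqrt 3 / 2)\<^sup>2"
    unfolding power2_norm_eq_inner
    by (simp add: hex_point_def inner_vec_def sum_2 power2_eq_square)
  also have "\<dots> = real_of_int ((2 * i - j)\<^sup>2 + 3 * j\<^sup>2) / 4"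
    by (simp add: power2_eq_square field_simps)
  finally show ?thesis .
qed

lemma hex_point_eq_iff: "hex_point (i, j) = hex_point (k, l) \<longleftrightarrow> i = k \<and> j = l"
proof
  assume "hex_point (i, j) = hex_point (k, l)"
  then have "hex_point (i - k, j - l) = 0"
    by (simp add: hex_point_diff[symmetric])
  then have "real_of_int ((2 * (i - k) - (j - l))\<^sup>2 + 3 * (j - l)\<^sup>2) = 0"
    using norm_hex_point[of "i - k" "j - l"] by simp
  then have *: "(2 * (i - k) - (j - l))\<^sup>2 + 3 * (j - l)\<^sup>2 = 0"
    by linarith
  then have "(j - l)\<^sup>2 = 0" "(2 * (i - k) - (j - l))\<^sup>2 = 0"
    using zero_le_power2[of "j - l"] zero_le_power2[of "2 * (i - k) - (j - l)"] by linarith+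
  then show "i = k \<and> j = l"
    by simp
qed simp

lemma norm_hex_point_le:
  assumes "(i, j) \<in> hex_disc r"
  shows "norm (hex_point (i, j)) \<le> real r / 2"
proof (rule power2_le_imp_le)
  have "real_of_int ((2 * i - j)\<^sup>2 + 3 * j\<^sup>2) \<le> real_of_int ((int r)\<^sup>2)"
    using assms unfolding hex_disc_def of_int_le_iff by simp
  then show "(norm (hex_point (i, j)))\<^sup>2 \<le> (real r / 2)\<^sup>2"
    unfolding norm_hex_point by (simp add: power_divide)
qed simp

text \<open>Within the cell congruence is equality, so the first alternative of
  \<open>parabola_differences\<close> contradicts distinctness and the second identifies the pairs.
  The radius \<open>r / 2\<close> gives the distance bound.\<close>

lemma DD_star_from_hex_cell:
  assumes "prime p" "p > 2"
  shows "\<exists>m D. DD_star m (real r) D \<and> card (hex_cell p r) \<le> p * m"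
proof -
  obtain c where c: "card (hex_cell p r) \<le> p * card {(i, j) \<in> hex_cell p r. [j + c = i\<^sup>2] (mod int p)}"
    using parabola_dense_translate[OF finite_hex_cell, of p p r] assms by auto
  define T where "T = {(i, j) \<in> hex_cell p r. [j + c = i\<^sup>2] (mod int p)}"
  have T: "finite T"
    unfolding T_def by (rule finite_subset[OF _ finite_hex_cell[of p r]]) auto
  have inj: "inj_on hex_point T"
    by (auto simp: inj_on_def hex_point_eq_iff)
  have "DD_star (card T) (real r) (hex_point ` T)"
    unfolding DD_star_def
  proof (intro conjI ballI)
    show "hex_point ` T \<subseteq> hex_grid"
      unfolding hex_grid_def hex_point_def by auto
    show "card (hex_point ` T) = card T"
      by (rule card_image[OF inj])
    have norm: "norm a \<le> real r / 2" if a: "a \<in> hex_point ` T" for a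
    proof -
      obtain i j where "a = hex_point (i, j)" "(i, j) \<in> hex_disc r"
        using a by (auto simp: T_def hex_cell_def)
      then show ?thesis
        by (simp only: norm_hex_point_le)
    qed
    show "dist a b \<le> real r" if "a \<in> hex_point ` T" "b \<in> hex_point ` T" for a b
      using norm_triangle_ineq4[of a b] norm[OF that(1)] norm[OF that(2)] by (simp add: dist_norm)
    show "inj_on (\<lambda>(a, b). a - b) {(a, b). a \<in> hex_point ` T \<and> b \<in> hex_point ` T \<and> a \<noteq> b}"
    proof (rule inj_onI, clarify)
      fix i1 j1 i2 j2 i3 j3 i4 j4
      assume mem: "(i1, j1) \<in> T" "(i2, j2) \<in> T" "(i3, j3) \<in> T" "(i4, j4) \<in> T"
        and neq: "hex_point (i1, j1) \<noteq> hex_point (i2, j2)"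
        and eq: "hex_point (i1, j1) - hex_point (i2, j2) = hex_point (i3, j3) - hex_point (i4, j4)"
      have diff: "i1 - i2 = i3 - i4" "j1 - j2 = j3 - j4"
        using eq unfolding hex_point_diff hex_point_eq_iff by auto
      have "[i1 = i2] (mod p) \<and> [j1 = j2] (mod p) \<or> [i1 = i3] (mod p) \<and> [j1 = j3] (mod p)"
        using mem by (intro parabola_differences[OF assms _ _ _ _ diff, of c]) (auto simp: T_def)
      moreover have "\<not> ([i1 = i2] (mod p) \<and> [j1 = j2] (mod p))"
        using hex_cell_cong_imp_eq[of i1 j1 p r i2 j2] mem neq by (auto simp: T_def)
      ultimately have "i1 = i3 \<and> j1 = j3"
        using hex_cell_cong_imp_eq[of i1 j1 p r i3 j3] mem by (auto simp: T_def)
      then show "hex_point (i1, j1) = hex_point (i3, j3) \<and> hex_point (i2, j2) = hex_point (i4, j4)"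
        using diff by (simp add: hex_point_eq_iff)
    qed
  qed (use T in simp)
  then show ?thesis
    using c unfolding T_def by blast
qed

lemma DD_star_ge:
  assumes "prime p" "0.869 * real r < real p" "real p \<le> 1.044 * real r" "r \<ge> 4"
  shows "\<exists>m D. DD_star m (real r) D \<and> sqrt (2 / sqrt 3) * 1.6165 * (real r / 2) - 27 \<le> real m"
proof -
  define h K where "h = real p / real r" and "K = sqrt 3 / 2 * (sqrt (2 / sqrt 3) * 1.6165)"
  have r: "real r \<ge> 4"
    using assms by simp
  then have "real p > 2"
    using assms(2) by simp
  then obtain m D where D: "DD_star m (real r) D" "card (hex_cell p r) \<le> p * m"
    using DD_star_from_hex_cell[OF assms(1), of r] by auto
  have h: "0.869 \<le> h" "h \<le> 1.044" "real p = h * real r"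
    using assms r by (auto simp: h_def field_simps)
  have K: "0 < K" "K \<le> 1.50433"
    using hexagon_constant_le by (auto simp: K_def)
  have "(real r)\<^sup>2 / sqrt 3 * (K * h) - 23 * real r \<le> real (card (hex_cell p r))"
  proof (cases "p \<le> r")
    case True
    then have "h \<le> 1"
      using r by (simp add: h_def)
    then have "K * h \<le> 6 * circ_area h - pi"
      using h(1) K(2) by (intro hexagon_area_bound)
    then have "(real r)\<^sup>2 / sqrt 3 * (K * h) \<le> (real r)\<^sup>2 / sqrt 3 * (6 * circ_area h - pi)"
      by (intro mult_left_mono) auto
    then show ?thesis
      using card_hex_cell_bounds(1)[of r p] True r unfolding h_def by simp
  next
    case False
    \<comment> \<open>This product, just below \<open>pi / 2\<close>, determines the upper limit
      1.044 for \<open>h\<close>.\<close>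
    have "K * h \<le> 1.50433 * 1.044"
      using h K by (intro mult_mono) auto
    then have "K * h \<le> pi / 2"
      using pi_approx by simp
    then have "(real r)\<^sup>2 / sqrt 3 * (K * h) \<le> (real r)\<^sup>2 / sqrt 3 * (pi / 2)"
      by (intro mult_left_mono) auto
    then show ?thesis
      using card_hex_cell_bounds(2)[of r p] False r by simp
  qed
  also have "\<dots> \<le> real (p * m)"
    using D(2) by (rule of_nat_mono)
  also have "(real r)\<^sup>2 / sqrt 3 * (K * h) = real p * (real r * (K / sqrt 3))"
    unfolding h(3) by (simp add: power2_eq_square)
  also have "K / sqrt 3 = sqrt (2 / sqrt 3) * 1.6165 / 2"
    by (simp add: K_def)
  finally have "real p * (sqrt (2 / sqrt 3) * 1.6165 * (real r / 2)) - 23 * real r \<le> real (p * m)"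
    by (simp add: mult_ac)
  \<comment> \<open>As \<open>0.869 * 27 > 23\<close>, dividing the error by \<open>p\<close> leaves
    at most 27.\<close>
  moreover have "23 * real r \<le> real p * 27"
    using assms(2) r by simp
  ultimately have "real p * (sqrt (2 / sqrt 3) * 1.6165 * (real r / 2) - 27) \<le> real p * real m"
    by (simp add: right_diff_distrib)
  then show ?thesis
    using D(1) \<open>real p > 2\<close> by (auto simp: mult_le_cancel_left)
qed

theorem theorem21:
  shows "\<exists>g :: nat \<Rightarrow> real. (\<lambda>r. g r / real r) \<longlonglongrightarrow> 0 \<and>
           (\<forall>r > 0. \<exists>m D. DD_star m (real r) D \<and>
              real m \<ge> sqrt (2 / sqrt 3) * mu * of_int \<lfloor>real r / 2\<rfloor> - g r)"
proof -
  define c where "c = sqrt (2 / sqrt 3) * 1.6165"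
  have c: "c > 0"
    by (simp add: c_def)
  have target: "sqrt (2 / sqrt 3) * mu * of_int \<lfloor>real r / 2\<rfloor> \<le> c * (real r / 2)" for r :: nat
  proof -
    have "sqrt (2 / sqrt 3) * mu * of_int \<lfloor>real r / 2\<rfloor> \<le> c * of_int \<lfloor>real r / 2\<rfloor>"
      unfolding c_def using mu_le by (intro mult_right_mono mult_left_mono) auto
    also have "\<dots> \<le> c * (real r / 2)"
      using c by (intro mult_left_mono of_int_floor_le) simp
    finally show ?thesis .
  qed
  \<comment> \<open>Here \<open>6/5 * 0.869 = 1.0428 < 1.044\<close>.\<close>
  have "\<forall>\<^sub>F r in sequentially. \<exists>p. prime p \<and> 0.869 * real r < real p \<and> real p \<le> 1.044 * real r"
    by (rule prime_in_interval) auto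
  then have "\<forall>\<^sub>F r in sequentially. \<exists>m D. DD_star m (real r) D \<and> c * (real r / 2) - 27 \<le> real m"
    using eventually_ge_at_top[of 4]
    by eventually_elim (use DD_star_ge c_def in blast)
  then obtain r0 where r0: "\<And>r. r \<ge> r0 \<Longrightarrow> \<exists>m D. DD_star m (real r) D \<and> c * (real r / 2) - 27 \<le> real m"
    unfolding eventually_sequentially by blast
  \<comment> \<open>One constant serves all \<open>r\<close>: it dominates 27, and for
    \<open>r < r0\<close> it dominates the whole target, so the empty set qualifies.\<close>
  define G where "G = c * (real r0 / 2) + 27"
  have "\<exists>m D. DD_star m (real r) D \<and> real m \<ge> sqrt (2 / sqrt 3) * mu * of_int \<lfloor>real r / 2\<rfloor> - G" for r :: nat
  proof (cases "r \<ge> r0")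
    case True
    then obtain m D where "DD_star m (real r) D" "c * (real r / 2) - 27 \<le> real m"
      using r0 by blast
    moreover have "27 \<le> G"
      using c by (simp add: G_def)
    ultimately have "DD_star m (real r) D \<and> real m \<ge> sqrt (2 / sqrt 3) * mu * of_int \<lfloor>real r / 2\<rfloor> - G"
      using target[of r] by linarith
    then show ?thesis
      by blast
  next
    case False
    then have "c * (real r / 2) \<le> G"
      using c by (simp add: G_def add_increasing2)
    moreover have "DD_star 0 (real r) {}"
      by (simp add: DD_star_def)
    ultimately have "DD_star 0 (real r) {} \<and> real 0 \<ge> sqrt (2 / sqrt 3) * mu * of_int \<lfloor>real r / 2\<rfloor> - G"
      using target[of r] by simp
    then show ?thesis
      by blast
  qed
  moreover have "(\<lambda>r. G / real r) \<longlonglongrightarrow> 0"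
    by (rule lim_const_over_n)
  ultimately show ?thesis
    by (intro exI[of _ "\<lambda>_. G"]) auto
qed

end
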